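(* Let $X\subset Y\subset Z$ be real Banach spaces, each a closed subspace of the next. If the pair $(X,Y)$ has the Daugavet property, then there is an equivalent norm $|||\cdot|||$ on $Z$ which coincides with the original norm on $Y$ and such that the pair $(X,(Z,|||\cdot|||))$ has the Daugavet property.
   Context: If $X$ is a closed subspace of a Banach space $Y$ with inclusion $J:X\to Y$, the pair $(X,Y)$ has the Daugavet property if every bounded linear operator $T:X\to Y$ of rank one satisfies $\|J+T\|=1+\|T\|$. *)

theory Defs
  imports "HOL-Analysis.Analysis"
begin

text \<open>All spaces live inside an ambient real Banach space type; a subspace carries the
restriction of a norm N on the ambient type.\<close>

definition is_norm :: "('a::real_vector \<Rightarrow> real) \<Rightarrow> bool" where
  "is_norm N \<longleftrightarrow> (\<forall>x y. N (x + y) \<le> N x + N y) \<and> (\<forall>c x. N (c *\<^sub>R x) = \<bar>c\<bar> * N x)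
     \<and> (\<forall>x. N x = 0 \<longrightarrow> x = 0)"

definition bounded_linear_op :: "('a::real_vector \<Rightarrow> real) \<Rightarrow> 'a set \<Rightarrow> 'a set \<Rightarrow> ('a \<Rightarrow> 'a) \<Rightarrow> bool" where
  "bounded_linear_op N X Y T \<longleftrightarrow>
     (\<forall>x\<in>X. T x \<in> Y) \<and>
     (\<forall>x\<in>X. \<forall>y\<in>X. T (x + y) = T x + T y) \<and>
     (\<forall>c. \<forall>x\<in>X. T (c *\<^sub>R x) = c *\<^sub>R T x) \<and>
     (\<exists>K. \<forall>x\<in>X. N (T x) \<le> K * N x)"

definition op_norm_on :: "('a::real_vector \<Rightarrow> real) \<Rightarrow> 'a set \<Rightarrow> ('a \<Rightarrow> 'a) \<Rightarrow> real" where
  "op_norm_on N X T = Sup {N (T x) | x. x \<in> X \<and> N x \<le> 1}"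

definition rank_one_on :: "'a set \<Rightarrow> ('a::real_vector \<Rightarrow> 'a) \<Rightarrow> bool" where
  "rank_one_on X T \<longleftrightarrow> dim (span (T ` X)) = 1"

definition daugavet_pair :: "('a::real_vector \<Rightarrow> real) \<Rightarrow> 'a set \<Rightarrow> 'a set \<Rightarrow> bool" where
  "daugavet_pair N X Y \<longleftrightarrow>
     (\<forall>T. bounded_linear_op N X Y T \<and> rank_one_on X T \<longrightarrow>
        op_norm_on N X (\<lambda>x. x + T x) = 1 + op_norm_on N X T)"

end

theory Submission
  imports Defs
begin

text \<open>By Zorn's lemma there is a minimal seminorm \<open>p\<close> on \<open>Z\<close> among those that are dominated by
the norm and agree with it on \<open>Y\<close>. The equivalent norm is \<open>N z = p z + dist z Y\<close>.
If \<open>r < p z\<close>, the seminorm \<open>w \<mapsto> inf\<^sub>t p (w - t z) + \<bar>t\<bar> r\<close> lies strictly below \<open>p\<close>, so it cannot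
agree with the norm on \<open>Y\<close>; this produces \<open>y \<in> Y\<close> with \<open>p (z - y) + r < \<parallel>y\<parallel>\<close>. For an operator
\<open>x \<mapsto> f x z\<close> the Daugavet property of \<open>(X, Y)\<close> for \<open>x \<mapsto> f x y\<close> gives \<open>x\<close> in the unit ball with
\<open>\<parallel>x + f x y\<parallel>\<close> almost \<open>1 + \<parallel>f\<parallel> \<parallel>y\<parallel>\<close>. Hence \<open>\<bar>f x\<bar>\<close> is almost \<open>\<parallel>f\<parallel>\<close>, and
\<open>p (x + f x z) \<ge> \<parallel>x + f x y\<parallel> - \<bar>f x\<bar> p (z - y)\<close> is almost at least \<open>1 + \<parallel>f\<parallel> p z\<close>.\<close>

section \<open>Seminorms\<close>

definition is_seminorm :: "('a::real_vector \<Rightarrow> real) \<Rightarrow> bool" where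
  "is_seminorm p \<longleftrightarrow> (\<forall>x y. p (x + y) \<le> p x + p y) \<and> (\<forall>c x. p (c *\<^sub>R x) = \<bar>c\<bar> * p x)"

text \<open>Applying the one-sided bound to \<open>inverse c\<close> and the vector
  \<open>c *\<^sub>R x\<close> yields the reverse inequality. For seminorms built as infima, only
  upper estimates of the infimum then have to be checked.\<close>

lemma is_seminormI:
  fixes p :: "'a::real_vector \<Rightarrow> real"
  assumes add: "\<And>x y. p (x + y) \<le> p x + p y"
    and scale: "\<And>c x. p (c *\<^sub>R x) \<le> \<bar>c\<bar> * p x"
  shows "is_seminorm p"
proof -
  have zero: "p 0 = 0"
    using add[of 0 0] scale[of 0 0] by simp
  have "\<bar>c\<bar> * p x \<le> p (c *\<^sub>R x)" for c x
  proof (cases "c = 0")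
    case True
    then show ?thesis using zero by simp
  next
    case False
    have "p x \<le> \<bar>inverse c\<bar> * p (c *\<^sub>R x)"
      using scale[of "inverse c" "c *\<^sub>R x"] False by simp
    then have "\<bar>c\<bar> * p x \<le> \<bar>c\<bar> * (\<bar>inverse c\<bar> * p (c *\<^sub>R x))"
      by (intro mult_left_mono) auto
    then show ?thesis using False by (simp flip: mult.assoc abs_mult)
  qed
  then show ?thesis
    unfolding is_seminorm_def using add scale by (auto intro: antisym)
qed

context
  fixes p :: "'a::real_vector \<Rightarrow> real"
  assumes p: "is_seminorm p"
begin

lemma seminorm_add: "p (x + y) \<le> p x + p y"
  using p by (simp add: is_seminorm_def)

lemma seminorm_scale: "p (c *\<^sub>R x) = \<bar>c\<bar> * p x"
  using p by (simp add: is_seminorm_def)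

lemma seminorm_zero: "p 0 = 0"
  using seminorm_scale[of 0 0] by simp

lemma seminorm_minus: "p (- x) = p x"
  using seminorm_scale[of "-1" x] by simp

lemma seminorm_nonneg: "0 \<le> p x"
  using seminorm_add[of x "- x"] by (simp add: seminorm_zero seminorm_minus)

lemma seminorm_triangle_sub: "p x \<le> p y + p (x - y)"
  using seminorm_add[of y "x - y"] by simp

end

lemma is_seminorm_norm: "is_seminorm (norm :: 'a::real_normed_vector \<Rightarrow> real)"
  by (simp add: is_seminorm_def norm_triangle_ineq)

lemma is_norm_iff_seminorm: "is_norm N \<longleftrightarrow> is_seminorm N \<and> (\<forall>x. N x = 0 \<longrightarrow> x = 0)"
  by (auto simp: is_norm_def is_seminorm_def)

lemma is_seminorm_plus:
  assumes "is_seminorm p" "is_seminorm q"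
  shows "is_seminorm (\<lambda>x. p x + q x)"
proof (rule is_seminormI)
  show "p (x + y) + q (x + y) \<le> (p x + q x) + (p y + q y)" for x y
    using seminorm_add[OF assms(1), of x y] seminorm_add[OF assms(2), of x y] by linarith
qed (simp add: seminorm_scale[OF assms(1)] seminorm_scale[OF assms(2)] distrib_left)

section \<open>Infimal convolutions and infima of chains of seminorms\<close>

lemma infconv_le:
  assumes "is_seminorm p" "is_seminorm g" "t \<in> V"
  shows "(INF t\<in>V. p (w - L t) + g t) \<le> p (w - L t) + g t"
  by (rule cINF_lower[OF _ assms(3)])
    (auto intro!: bdd_belowI[of _ 0] add_nonneg_nonneg
      simp: seminorm_nonneg[OF assms(1)] seminorm_nonneg[OF assms(2)])

text \<open>Candidates add up and scale: if \<open>s\<close> competes for \<open>x\<close> and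
  \<open>t\<close> for \<open>y\<close>, then \<open>s + t\<close> competes for
  \<open>x + y\<close>. Two instances matter later: \<open>L t = t *\<^sub>R z\<close> over the
  reals, which lowers a seminorm at \<open>z\<close>, and \<open>L = id\<close> on \<open>Y\<close>
  with \<open>g = 0\<close>, which is the distance to \<open>Y\<close>.\<close>

lemma is_seminorm_infconv:
  fixes L :: "'b::real_vector \<Rightarrow> 'a::real_vector"
  assumes p: "is_seminorm p" and g: "is_seminorm g" and L: "linear L" and V: "subspace V"
  shows "is_seminorm (\<lambda>w. INF t\<in>V. p (w - L t) + g t)" (is "is_seminorm ?q")
proof (rule is_seminormI)
  have ne: "V \<noteq> {}" using subspace_0[OF V] by auto
  note le = infconv_le[OF p g]
  show "?q (x + y) \<le> ?q x + ?q y" for x y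
  proof -
    have *: "?q (x + y) \<le> (p (x - L s) + g s) + (p (y - L t) + g t)" if "s \<in> V" "t \<in> V" for s t
    proof -
      have "?q (x + y) \<le> p (x + y - L (s + t)) + g (s + t)"
        by (rule le) (use V that subspace_add in blast)
      also have "x + y - L (s + t) = (x - L s) + (y - L t)"
        by (simp add: linear_add[OF L])
      also have "p \<dots> + g (s + t) \<le> (p (x - L s) + g s) + (p (y - L t) + g t)"
        using seminorm_add[OF p, of "x - L s" "y - L t"] seminorm_add[OF g, of s t] by linarith
      finally show ?thesis .
    qed
    have "?q (x + y) - (p (y - L t) + g t) \<le> ?q x" if "t \<in> V" for t
      by (rule cINF_greatest[OF ne]) (use *[OF _ that] in \<open>simp add: algebra_simps\<close>)
    then have "?q (x + y) - ?q x \<le> ?q y"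
      by (intro cINF_greatest[OF ne]) (simp add: algebra_simps)
    then show ?thesis by simp
  qed
  show "?q (c *\<^sub>R x) \<le> \<bar>c\<bar> * ?q x" for c x
  proof -
    have *: "?q (c *\<^sub>R x) \<le> \<bar>c\<bar> * (p (x - L t) + g t)" if "t \<in> V" for t
    proof -
      have "?q (c *\<^sub>R x) \<le> p (c *\<^sub>R x - L (c *\<^sub>R t)) + g (c *\<^sub>R t)"
        by (rule le) (use V that subspace_scale in blast)
      also have "c *\<^sub>R x - L (c *\<^sub>R t) = c *\<^sub>R (x - L t)"
        by (simp add: linear_scale[OF L] scaleR_diff_right)
      finally show ?thesis
        by (simp add: seminorm_scale[OF p] seminorm_scale[OF g] distrib_left)
    qed
    show ?thesis
    proof (cases "c = 0")
      case True
      then show ?thesis using *[OF subspace_0[OF V]] by simp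
    next
      case False
      have "?q (c *\<^sub>R x) / \<bar>c\<bar> \<le> ?q x"
        by (rule cINF_greatest[OF ne]) (use * False in \<open>simp add: field_simps\<close>)
      then show ?thesis using False by (simp add: field_simps)
    qed
  qed
qed

text \<open>A pointwise infimum of seminorms need not be subadditive. In a chain, however, any two
  members \<open>q\<close> and \<open>q'\<close> have a common lower member \<open>s\<close>, and
  the triangle inequality for \<open>s\<close> bounds the infimum at \<open>x + y\<close> by
  \<open>q x + q' y\<close>.\<close>

lemma is_seminorm_INF_chain:
  fixes C :: "('a::real_vector \<Rightarrow> real) set"
  assumes ne: "C \<noteq> {}" and sn: "\<And>q. q \<in> C \<Longrightarrow> is_seminorm q"
    and chain: "\<And>q q'. q \<in> C \<Longrightarrow> q' \<in> C \<Longrightarrow> q \<le> q' \<or> q' \<le> q"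
  shows "is_seminorm (\<lambda>x. INF q\<in>C. q x)" (is "is_seminorm ?u")
proof (rule is_seminormI)
  have le: "?u x \<le> q x" if "q \<in> C" for q x
    by (rule cINF_lower[OF _ that]) (auto intro!: bdd_belowI[of _ 0] simp: seminorm_nonneg[OF sn])
  show "?u (x + y) \<le> ?u x + ?u y" for x y
  proof -
    have *: "?u (x + y) \<le> q x + q' y" if "q \<in> C" "q' \<in> C" for q q'
    proof -
      obtain s where s: "s \<in> C" "s \<le> q" "s \<le> q'"
        using chain[of q q'] \<open>q \<in> C\<close> \<open>q' \<in> C\<close> by blast
      have "?u (x + y) \<le> s (x + y)" by (rule le[OF s(1)])
      also have "\<dots> \<le> s x + s y" by (rule seminorm_add[OF sn[OF s(1)]])
      also have "\<dots> \<le> q x + q' y" using s by (intro add_mono) (auto simp: le_fun_def)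
      finally show ?thesis .
    qed
    have "?u (x + y) - q' y \<le> ?u x" if "q' \<in> C" for q'
      by (rule cINF_greatest[OF ne]) (use *[OF _ that] in \<open>simp add: algebra_simps\<close>)
    then have "?u (x + y) - ?u x \<le> ?u y"
      by (intro cINF_greatest[OF ne]) (simp add: algebra_simps)
    then show ?thesis by simp
  qed
  show "?u (c *\<^sub>R x) \<le> \<bar>c\<bar> * ?u x" for c x
  proof -
    have *: "?u (c *\<^sub>R x) \<le> \<bar>c\<bar> * q x" if "q \<in> C" for q
      using le[OF that, of "c *\<^sub>R x"] by (simp add: seminorm_scale[OF sn[OF that]])
    show ?thesis
    proof (cases "c = 0")
      case True
      then show ?thesis using * ne by auto
    next
      case False
      have "?u (c *\<^sub>R x) / \<bar>c\<bar> \<le> ?u x"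
        by (rule cINF_greatest[OF ne]) (use * False in \<open>simp add: field_simps\<close>)
      then show ?thesis using False by (simp add: field_simps)
    qed
  qed
qed

section \<open>Minimal seminorms extending the norm of \<open>Y\<close>\<close>

definition norm_extensions :: "'a::real_normed_vector set \<Rightarrow> ('a \<Rightarrow> real) set" where
  "norm_extensions Y = {q. is_seminorm q \<and> (\<forall>z. q z \<le> norm z) \<and> (\<forall>y\<in>Y. q y = norm y)}"

lemma minimal_norm_extension_exists:
  fixes Y :: "'a::real_normed_vector set"
  obtains p where "p \<in> norm_extensions Y"
    and "\<And>q. q \<in> norm_extensions Y \<Longrightarrow> q \<le> p \<Longrightarrow> q = p"
proof -
  \<comment> \<open>The order is reversed, so that the maximal element supplied by Zorn's lemma is a
    minimal seminorm.\<close>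
  let ?A = "norm_extensions Y" and ?P = "\<lambda>q q'. q' \<le> (q :: 'a \<Rightarrow> real)"
  have "\<exists>m\<in>?A. \<forall>a\<in>?A. ?P m a \<longrightarrow> a = m"
  proof (rule predicate_Zorn)
    show "partial_order_on ?A (relation_of ?P ?A)"
      by (rule partial_order_on_relation_ofI) auto
    fix C assume "C \<in> Chains (relation_of ?P ?A)"
    then have CA: "C \<subseteq> ?A" and chain: "\<And>q q'. q \<in> C \<Longrightarrow> q' \<in> C \<Longrightarrow> q \<le> q' \<or> q' \<le> q"
      by (auto simp: Chains_def relation_of_def)
    have sn: "is_seminorm q" if "q \<in> C" for q
      using CA that by (auto simp: norm_extensions_def)
    show "\<exists>u\<in>?A. \<forall>a\<in>C. ?P a u"
    proof (cases "C = {}")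
      case True
      then show ?thesis
        by (intro bexI[of _ norm]) (auto simp: norm_extensions_def is_seminorm_norm)
    next
      case False
      let ?u = "\<lambda>x. INF q\<in>C. q x"
      have le: "?u x \<le> q x" if "q \<in> C" for q x
        by (rule cINF_lower[OF _ that]) (auto intro!: bdd_belowI[of _ 0] simp: seminorm_nonneg[OF sn])
      obtain q0 where q0: "q0 \<in> C" using False by blast
      have "?u z \<le> norm z" for z
        using le[OF q0, of z] q0 CA by (force simp: norm_extensions_def intro: order_trans)
      moreover have "?u y = norm y" if "y \<in> Y" for y
      proof -
        have "?u y = (INF q\<in>C. norm y)"
          by (rule INF_cong) (use CA that in \<open>auto simp: norm_extensions_def\<close>)
        then show ?thesis using False by simp
      qed
      ultimately have "?u \<in> ?A"
        using is_seminorm_INF_chain[OF False sn chain] by (simp add: norm_extensions_def)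
      then show ?thesis using le by (intro bexI[of _ ?u]) (auto simp: le_fun_def)
    qed
  qed
  then show ?thesis using that by blast
qed

lemma minimal_norm_extension_approx:
  fixes Y :: "'a::real_normed_vector set"
  assumes Y: "subspace Y" and p: "p \<in> norm_extensions Y"
    and min: "\<And>q. q \<in> norm_extensions Y \<Longrightarrow> q \<le> p \<Longrightarrow> q = p"
    and r: "0 \<le> r" "r < p z"
  obtains y where "y \<in> Y" "y \<noteq> 0" "p (z - y) + r < norm y"
proof -
  have sn: "is_seminorm p" and le: "\<And>w. p w \<le> norm w" and eq: "\<And>y. y \<in> Y \<Longrightarrow> p y = norm y"
    using p by (auto simp: norm_extensions_def)
  have g: "is_seminorm (\<lambda>t::real. \<bar>t\<bar> * r)"
    by (rule is_seminormI)
      (use r(1) in \<open>auto simp: abs_mult simp flip: distrib_right intro!: mult_right_mono\<close>)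
  have L: "linear (\<lambda>t. t *\<^sub>R z)"
    by (simp add: linear_iff scaleR_add_left)
  define q where "q = (\<lambda>w. INF t\<in>UNIV. p (w - t *\<^sub>R z) + \<bar>t\<bar> * r)"
  have qle: "q w \<le> p (w - t *\<^sub>R z) + \<bar>t\<bar> * r" for w t
    unfolding q_def by (rule infconv_le[OF sn g, where L = "\<lambda>t. t *\<^sub>R z"]) simp
  \<comment> \<open>The choice \<open>t = 0\<close> gives \<open>q \<le> p\<close>, and
    \<open>t = 1\<close> gives \<open>q z \<le> r < p z\<close>, so \<open>q\<close> lies strictly
    below \<open>p\<close>.\<close>
  have "q \<le> p"
    using qle[of _ 0] by (simp add: le_fun_def)
  moreover have "q \<noteq> p"
    using qle[of z 1] r by (auto simp: seminorm_zero[OF sn])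
  ultimately have "q \<notin> norm_extensions Y"
    using min by blast
  moreover have "is_seminorm q"
    unfolding q_def by (rule is_seminorm_infconv[OF sn g L]) simp
  moreover have "q w \<le> norm w" for w
    using \<open>q \<le> p\<close> le[of w] by (auto simp: le_fun_def intro: order_trans)
  ultimately obtain y where y: "y \<in> Y" "q y \<noteq> norm y"
    by (auto simp: norm_extensions_def)
  have "q y < norm y"
    using y \<open>q \<le> p\<close> eq[of y] by (simp add: le_fun_def less_le) metis
  then obtain t where t: "p (y - t *\<^sub>R z) + \<bar>t\<bar> * r < norm y"
    unfolding q_def by (meson UNIV_I UNIV_not_empty cINF_greatest not_le)
  \<comment> \<open>For \<open>t = 0\<close> the inequality would read \<open>p y < norm y\<close>,
    although \<open>p\<close> is the norm on \<open>Y\<close>. Dividing by \<open>t\<close> then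
    normalises the multiple of \<open>z\<close> to \<open>z\<close> itself.\<close>
  have "t \<noteq> 0"
    using t eq[OF y(1)] by auto
  let ?y = "inverse t *\<^sub>R y"
  have "y - t *\<^sub>R z = (- t) *\<^sub>R (z - ?y)"
    using \<open>t \<noteq> 0\<close> by (simp add: scaleR_diff_right)
  then have "p (y - t *\<^sub>R z) = \<bar>t\<bar> * p (z - ?y)"
    by (simp only: seminorm_scale[OF sn] abs_minus_cancel)
  moreover have "norm y = \<bar>t\<bar> * norm ?y"
    using \<open>t \<noteq> 0\<close> by simp
  ultimately have "\<bar>t\<bar> * (p (z - ?y) + r) < \<bar>t\<bar> * norm ?y"
    using t by (simp only: distrib_left)
  then have *: "p (z - ?y) + r < norm ?y"
    by (rule mult_left_less_imp_less) simp
  moreover have "?y \<noteq> 0"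
    using * seminorm_nonneg[OF sn, of "z - ?y"] r(1) by (metis add_nonneg_nonneg norm_zero not_le)
  ultimately show ?thesis
    using that[of ?y] y(1) Y by (simp add: subspace_scale)
qed

section \<open>Rank-one operators as a functional times a vector\<close>

text \<open>The range lies on the line through a basis vector \<open>v\<close>, and \<open>f\<close>
  is the coordinate along it. Cancelling \<open>v\<close> transfers linearity from \<open>T\<close>
  to \<open>f\<close>, and dividing by \<open>N v > 0\<close> transfers boundedness.\<close>

lemma bounded_rank_one_opE:
  fixes T :: "'a::real_vector \<Rightarrow> 'a"
  assumes X: "subspace X" and N: "is_norm N"
    and T: "bounded_linear_op N X Y T" and rank: "rank_one_on X T"
  obtains f v where "v \<noteq> 0" "\<And>x. x \<in> X \<Longrightarrow> T x = f x *\<^sub>R v"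
    "\<And>x y. x \<in> X \<Longrightarrow> y \<in> X \<Longrightarrow> f (x + y) = f x + f y"
    "\<And>c x. x \<in> X \<Longrightarrow> f (c *\<^sub>R x) = c * f x"
    "\<exists>K. \<forall>x\<in>X. \<bar>f x\<bar> \<le> K * N x" "\<exists>x\<in>X. f x \<noteq> 0"
proof -
  obtain B where B: "B \<subseteq> span (T ` X)" "independent B" "span (T ` X) \<subseteq> span B" "card B = 1"
    using basis_exists[of "span (T ` X)"] rank unfolding rank_one_on_def by metis
  then obtain v where v: "B = {v}" by (auto simp: card_1_singleton_iff)
  have v0: "v \<noteq> 0" using B(2) v dependent_single by auto
  have "\<exists>k. T x = k *\<^sub>R v" if "x \<in> X" for x
    using B(3) v that span_base[of "T x" "T ` X"] by (auto simp: span_singleton)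
  then obtain f where f: "\<And>x. x \<in> X \<Longrightarrow> T x = f x *\<^sub>R v" by metis
  have Nv: "N v > 0"
    using N v0 seminorm_nonneg[of N v] by (auto simp: is_norm_iff_seminorm less_le)
  have "f (x + y) = f x + f y" if "x \<in> X" "y \<in> X" for x y
  proof -
    have "f (x + y) *\<^sub>R v = T (x + y)"
      using that X by (simp add: f subspace_add)
    also have "\<dots> = T x + T y"
      using T that by (simp add: bounded_linear_op_def)
    also have "\<dots> = (f x + f y) *\<^sub>R v" using that by (simp add: f scaleR_add_left)
    finally show ?thesis using v0 by simp
  qed
  moreover have "f (c *\<^sub>R x) = c * f x" if "x \<in> X" for c x
  proof -
    have "f (c *\<^sub>R x) *\<^sub>R v = T (c *\<^sub>R x)"
      using that X by (simp add: f subspace_scale)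
    also have "\<dots> = c *\<^sub>R T x"
      using T that by (simp add: bounded_linear_op_def)
    also have "\<dots> = (c * f x) *\<^sub>R v" using that by (simp add: f)
    finally show ?thesis using v0 by simp
  qed
  moreover have "\<exists>K. \<forall>x\<in>X. \<bar>f x\<bar> \<le> K * N x"
  proof -
    obtain K where K: "\<And>x. x \<in> X \<Longrightarrow> N (T x) \<le> K * N x"
      using T unfolding bounded_linear_op_def by blast
    have "\<bar>f x\<bar> \<le> K / N v * N x" if "x \<in> X" for x
      using K[OF that] N Nv that by (simp add: f is_norm_def field_simps)
    then show ?thesis by blast
  qed
  moreover have "\<exists>x\<in>X. f x \<noteq> 0"
  proof (rule ccontr)
    assume "\<not> ?thesis"
    then have "T ` X \<subseteq> {0}" using f by auto
    then have "span (T ` X) \<subseteq> {0}" by (metis span_mono span_0 span_empty span_insert_0)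
    then show False using B(1) v v0 by auto
  qed
  ultimately show ?thesis using that[OF v0 f] by blast
qed

lemma functional_bdd_above:
  assumes N: "is_seminorm N" and f_bounded: "\<exists>K. \<forall>x\<in>X. \<bar>f x\<bar> \<le> K * N x"
  shows "bdd_above {\<bar>f x\<bar> | x. x \<in> X \<and> N x \<le> 1}"
proof -
  obtain K where K: "\<And>x. x \<in> X \<Longrightarrow> \<bar>f x\<bar> \<le> K * N x" using f_bounded by blast
  have "\<bar>f x\<bar> \<le> \<bar>K\<bar>" if "x \<in> X" "N x \<le> 1" for x
  proof -
    have "K * N x \<le> \<bar>K\<bar> * 1"
      using that seminorm_nonneg[OF N, of x] by (intro mult_mono) auto
    then show ?thesis using K[OF that(1)] by simp
  qed
  then show ?thesis by (auto intro!: bdd_aboveI[of _ "\<bar>K\<bar>"])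
qed

text \<open>Multiplication by \<open>N v \<ge> 0\<close> is monotone and continuous, hence commutes
  with the supremum of a nonempty set that is bounded above.\<close>

lemma op_norm_on_rank_one:
  assumes N: "is_seminorm N" and X: "subspace X" and f_bounded: "\<exists>K. \<forall>x\<in>X. \<bar>f x\<bar> \<le> K * N x"
  shows "op_norm_on N X (\<lambda>x. f x *\<^sub>R v) = Sup {\<bar>f x\<bar> | x. x \<in> X \<and> N x \<le> 1} * N v"
proof -
  let ?F = "{\<bar>f x\<bar> | x. x \<in> X \<and> N x \<le> 1}"
  have "0 \<in> X \<and> N 0 \<le> 1" using X by (simp add: subspace_0 seminorm_zero[OF N])
  then have ne: "?F \<noteq> {}" by blast
  have "Sup ?F * N v = Sup ((\<lambda>s. s * N v) ` ?F)"
    by (rule continuous_at_Sup_mono[OF _ _ ne functional_bdd_above[OF N f_bounded]])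
      (auto intro!: monoI mult_right_mono continuous_intros simp: seminorm_nonneg[OF N])
  also have "(\<lambda>s. s * N v) ` ?F = {N (f x *\<^sub>R v) | x. x \<in> X \<and> N x \<le> 1}"
    by (auto simp: seminorm_scale[OF N] image_iff)
  finally show ?thesis by (simp add: op_norm_on_def)
qed

lemma bounded_linear_op_rank_one:
  assumes N: "is_seminorm N"
    and f_add: "\<And>x y. x \<in> X \<Longrightarrow> y \<in> X \<Longrightarrow> f (x + y) = f x + f y"
    and f_scale: "\<And>c x. x \<in> X \<Longrightarrow> f (c *\<^sub>R x) = c * f x"
    and f_bounded: "\<exists>K. \<forall>x\<in>X. \<bar>f x\<bar> \<le> K * N x"
    and Y: "subspace Y" "y \<in> Y"
  shows "bounded_linear_op N X Y (\<lambda>x. f x *\<^sub>R y)"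
proof -
  obtain K where K: "\<And>x. x \<in> X \<Longrightarrow> \<bar>f x\<bar> \<le> K * N x" using f_bounded by blast
  have "N (f x *\<^sub>R y) \<le> (K * N y) * N x" if "x \<in> X" for x
    using mult_right_mono[OF K[OF that] seminorm_nonneg[OF N, of y]]
    by (simp add: seminorm_scale[OF N] mult_ac)
  then show ?thesis
    using Y unfolding bounded_linear_op_def
    by (auto simp: f_add f_scale scaleR_add_left subspace_scale)
qed

lemma rank_one_on_functional:
  assumes "x \<in> X" "f x \<noteq> 0" "y \<noteq> 0"
  shows "rank_one_on X (\<lambda>x. f x *\<^sub>R y)"
proof -
  have "span ((\<lambda>x. f x *\<^sub>R y) ` X) = span {y}"
  proof (rule antisym)
    show "span ((\<lambda>x. f x *\<^sub>R y) ` X) \<subseteq> span {y}"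
      by (rule span_minimal) (auto intro: span_scale span_base)
    have "inverse (f x) *\<^sub>R (f x *\<^sub>R y) \<in> span ((\<lambda>x. f x *\<^sub>R y) ` X)"
      by (rule span_scale) (use assms(1) in \<open>auto intro: span_base\<close>)
    then show "span {y} \<subseteq> span ((\<lambda>x. f x *\<^sub>R y) ` X)"
      using assms(2) by (intro span_minimal) auto
  qed
  then show ?thesis
    using assms(3) dim_eq_card_independent[of "{y}"] by (simp add: rank_one_on_def)
qed

section \<open>The equivalent norm on \<open>Z\<close> and its Daugavet property\<close>

theorem mainTheorem13:
  fixes X Y :: "'z::banach set"
  assumes "subspace X" "closed X" "subspace Y" "closed Y" "X \<subseteq> Y"
    and "daugavet_pair norm X Y"
  shows "\<exists>N :: 'z \<Rightarrow> real. is_norm N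
           \<and> (\<exists>c C. 0 < c \<and> 0 < C \<and> (\<forall>z. c * norm z \<le> N z \<and> N z \<le> C * norm z))
           \<and> (\<forall>y\<in>Y. N y = norm y)
           \<and> daugavet_pair N X UNIV"
proof -
  note X = assms(1) and Y = assms(3) and XY = assms(5)
  obtain p where p: "p \<in> norm_extensions Y"
    and min: "\<And>q. q \<in> norm_extensions Y \<Longrightarrow> q \<le> p \<Longrightarrow> q = p"
    using minimal_norm_extension_exists by blast
  have sn: "is_seminorm p" and ple: "\<And>z. p z \<le> norm z" and peq: "\<And>y. y \<in> Y \<Longrightarrow> p y = norm y"
    using p by (auto simp: norm_extensions_def)
  \<comment> \<open>This is the distance to \<open>Y\<close> in the original norm; the summand
    \<open>0\<close> puts it in the form of an infimal convolution.\<close>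
  define d where "d = (\<lambda>z. INF y\<in>Y. norm (z - y) + 0)"
  have zsn: "is_seminorm (\<lambda>_::'z. 0)" by (simp add: is_seminorm_def)
  have d: "is_seminorm d"
    unfolding d_def
    using is_seminorm_infconv[OF is_seminorm_norm zsn linear_id Y] by simp
  have dle: "d z \<le> norm (z - y)" if "y \<in> Y" for z y
    unfolding d_def using infconv_le[OF is_seminorm_norm zsn that, of z id] by simp
  have dY: "d y = 0" if "y \<in> Y" for y
    using dle[OF that, of y] seminorm_nonneg[OF d, of y] by simp
  define N where "N = (\<lambda>z. p z + d z)"
  have N: "is_seminorm N" unfolding N_def by (rule is_seminorm_plus[OF sn d])
  have NY: "N y = norm y" if "y \<in> Y" for y
    using that by (simp add: N_def peq dY)
  have upper: "N z \<le> 2 * norm z" for z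
    using ple[of z] dle[OF subspace_0[OF Y], of z] by (simp add: N_def)
  have lower: "1/2 * norm z \<le> N z" for z
  proof -
    \<comment> \<open>For \<open>y\<close> in \<open>Y\<close>, passing from \<open>z\<close> to
      \<open>y\<close> in the norm and back in \<open>p\<close> costs \<open>norm (z - y)\<close>
      each time, so \<open>norm z \<le> p z + 2 * norm (z - y)\<close>. Thus \<open>d\<close> makes
      up for whatever \<open>p\<close> loses away from \<open>Y\<close>.\<close>
    have "(norm z - p z) / 2 \<le> d z"
      unfolding d_def
    proof (rule cINF_greatest)
      show "Y \<noteq> {}" using subspace_0[OF Y] by auto
      fix y assume y: "y \<in> Y"
      have "norm z \<le> p y + norm (z - y)"
        using norm_triangle_sub[of z y] peq[OF y] by simp
      also have "p y \<le> p z + p (y - z)"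
        by (rule seminorm_triangle_sub[OF sn])
      also have "p (y - z) \<le> norm (z - y)"
        using ple[of "y - z"] by (simp add: norm_minus_commute)
      finally show "(norm z - p z) / 2 \<le> norm (z - y) + 0" by simp
    qed
    then show ?thesis using seminorm_nonneg[OF sn, of z] by (simp add: N_def)
  qed
  have norm: "is_norm N"
    unfolding is_norm_iff_seminorm
  proof (intro conjI allI impI N)
    show "z = 0" if "N z = 0" for z using lower[of z] that by simp
  qed
  \<comment> \<open>If \<open>p z = 0\<close>, no \<open>r\<close> with
    \<open>0 \<le> r < p z\<close> exists, and the nonzero vector \<open>y0\<close> serves instead.
    Otherwise \<open>r = max 0 (p z - e)\<close> is admissible. A nonzero \<open>y\<close> is
    required to keep the approximating operator of rank one.\<close>
  have approx: "\<exists>y\<in>Y. y \<noteq> 0 \<and> p (z - y) + p z - e < norm y"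
    if "0 < e" "y0 \<in> Y" "y0 \<noteq> 0" for z e y0
  proof (cases "p z = 0")
    case True
    have "p (z - y0) \<le> norm y0"
      using seminorm_add[OF sn, of z "- y0"] True that by (simp add: seminorm_minus[OF sn] peq)
    then show ?thesis using that True by (intro bexI[of _ y0]) auto
  next
    case False
    then have "0 \<le> max 0 (p z - e)" "max 0 (p z - e) < p z"
      using seminorm_nonneg[OF sn, of z] that(1) by auto
    then obtain y where "y \<in> Y" "y \<noteq> 0" "p (z - y) + max 0 (p z - e) < norm y"
      using minimal_norm_extension_approx[OF Y p min] by blast
    then show ?thesis by (intro bexI[of _ y]) auto
  qed
  have "daugavet_pair N X UNIV"
    unfolding daugavet_pair_def
  proof (intro allI impI)
    fix T assume "bounded_linear_op N X UNIV T \<and> rank_one_on X T"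
    then have T: "bounded_linear_op N X UNIV T" "rank_one_on X T" by auto
    obtain f v where "v \<noteq> 0" and Tf: "\<And>x. x \<in> X \<Longrightarrow> T x = f x *\<^sub>R v"
      and f_add: "\<And>x y. x \<in> X \<Longrightarrow> y \<in> X \<Longrightarrow> f (x + y) = f x + f y"
      and f_scale: "\<And>c x. x \<in> X \<Longrightarrow> f (c *\<^sub>R x) = c * f x"
      and f_bd: "\<exists>K. \<forall>x\<in>X. \<bar>f x\<bar> \<le> K * N x" and f_nz: "\<exists>x\<in>X. f x \<noteq> 0"
      by (rule bounded_rank_one_opE[OF X norm T]) (rule that)
    have NX: "N x = norm x" if "x \<in> X" for x using NY XY that by blast
    have f_bd': "\<exists>K. \<forall>x\<in>X. \<bar>f x\<bar> \<le> K * norm x" using f_bd NX by auto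
    \<comment> \<open>This is the norm of the functional \<open>f\<close>; it is the same for
      \<open>N\<close> and the original norm, which agree on \<open>X\<close>.\<close>
    define \<phi> where "\<phi> = Sup {\<bar>f x\<bar> | x. x \<in> X \<and> norm x \<le> 1}"
    have f_le: "\<bar>f x\<bar> \<le> \<phi>" if "x \<in> X" "norm x \<le> 1" for x
      unfolding \<phi>_def
      by (rule cSup_upper[OF _ functional_bdd_above[OF is_seminorm_norm f_bd']]) (use that in blast)
    have "\<phi> \<ge> 0" using f_le[OF subspace_0[OF X]] by simp
    have eqs: "{\<bar>f x\<bar> | x. x \<in> X \<and> N x \<le> 1} = {\<bar>f x\<bar> | x. x \<in> X \<and> norm x \<le> 1}"
      using NX by auto
    have "{N (T x) | x. x \<in> X \<and> N x \<le> 1} = {N (f x *\<^sub>R v) | x. x \<in> X \<and> N x \<le> 1}"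
      using Tf by (intro Collect_cong) metis
    then have normT: "op_norm_on N X T = \<phi> * N v"
      using op_norm_on_rank_one[OF N X f_bd, of v] by (simp add: op_norm_on_def eqs \<phi>_def)
    obtain x0 where x0: "x0 \<in> X" "f x0 \<noteq> 0" using f_nz by blast
    have "x0 \<noteq> 0" using x0 f_scale[OF subspace_0[OF X], of 0] by auto
    let ?S = "{N (x + T x) | x. x \<in> X \<and> N x \<le> 1}"
    \<comment> \<open>The easy inequality; it also shows that \<open>?S\<close> is bounded above,
      which the lower estimate of \<open>Sup ?S\<close> relies on.\<close>
    have ub: "s \<le> 1 + \<phi> * N v" if s: "s \<in> ?S" for s
    proof -
      obtain x where x: "s = N (x + T x)" "x \<in> X" "N x \<le> 1" using s by blast
      have "s \<le> N x + \<bar>f x\<bar> * N v"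
        using seminorm_add[OF N, of x "T x"] x by (simp add: Tf seminorm_scale[OF N])
      also have "\<dots> \<le> 1 + \<phi> * N v"
        using x f_le[of x] NX by (intro add_mono mult_right_mono seminorm_nonneg N) auto
      finally show ?thesis .
    qed
    have ne: "?S \<noteq> {}" using subspace_0[OF X] seminorm_zero[OF N] by force
    have "1 + \<phi> * N v \<le> Sup ?S + e" if "0 < e" for e
    proof -
      \<comment> \<open>The error budget \<open>e\<close> is split in halves. Replacing
        \<open>v\<close> by \<open>y\<close> costs at most \<open>\<phi> * ?e \<le> e / 2\<close>;
        the \<open>+ 1\<close> keeps the denominator positive.\<close>
      let ?e = "e / (2 * (\<phi> + 1))"
      have "0 < ?e" using that \<open>\<phi> \<ge> 0\<close> by simp
      then obtain y where y: "y \<in> Y" "y \<noteq> 0" "p (v - y) + p v - ?e < norm y"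
        using approx[of ?e x0 v] x0 XY \<open>x0 \<noteq> 0\<close> by blast
      \<comment> \<open>Near-optimality of \<open>x\<close> up to \<open>\<delta>\<close> costs
        \<open>\<delta>\<close> in the estimate for \<open>p\<close> and
        \<open>\<delta> * (d v / norm y)\<close> in the one for \<open>d\<close>, together exactly
        \<open>e / 2\<close>. Since \<open>\<delta>\<close> depends on \<open>norm y\<close>, it is
        fixed after \<open>y\<close>.\<close>
      define \<delta> where "\<delta> = e / 2 / (1 + d v / norm y)"
      have den: "0 < 1 + d v / norm y"
        using seminorm_nonneg[OF d, of v] by (simp add: add_pos_nonneg)
      then have "\<delta> > 0" using that by (simp add: \<delta>_def)
      \<comment> \<open>The hypothesis on \<open>(X, Y)\<close> applies because \<open>y\<close>
        lies in \<open>Y\<close>, which need not hold for \<open>v\<close>.\<close>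
      have "op_norm_on norm X (\<lambda>x. x + f x *\<^sub>R y) = 1 + \<phi> * norm y"
        using assms(6) bounded_linear_op_rank_one[OF is_seminorm_norm f_add f_scale f_bd' Y y(1)]
          rank_one_on_functional[of x0 X f y] x0 y(2)
          op_norm_on_rank_one[OF is_seminorm_norm X f_bd', of y]
        by (simp add: daugavet_pair_def \<phi>_def)
      then have "1 + \<phi> * norm y - \<delta> < Sup {norm (x + f x *\<^sub>R y) | x. x \<in> X \<and> norm x \<le> 1}"
        using \<open>\<delta> > 0\<close> by (simp add: op_norm_on_def)
      moreover have "{norm (x + f x *\<^sub>R y) | x. x \<in> X \<and> norm x \<le> 1} \<noteq> {}"
        using subspace_0[OF X] by force
      ultimately obtain x where x: "x \<in> X" "norm x \<le> 1"
        and big: "1 + \<phi> * norm y - \<delta> < norm (x + f x *\<^sub>R y)"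
        using less_cSupD by (smt (verit) mem_Collect_eq)
      \<comment> \<open>Since \<open>x\<close> contributes at most \<open>1\<close> to the norm, a
        nearly maximal sum forces \<open>\<bar>f x\<bar>\<close> to be close to
        \<open>\<phi>\<close>.\<close>
      have "norm (x + f x *\<^sub>R y) \<le> 1 + \<bar>f x\<bar> * norm y"
        using norm_triangle_ineq[of x "f x *\<^sub>R y"] x(2) by simp
      then have "\<phi> * norm y - \<delta> \<le> \<bar>f x\<bar> * norm y" using big by linarith
      then have fx: "\<phi> - \<delta> / norm y \<le> \<bar>f x\<bar>"
        using y(2) by (simp add: field_simps)
      have xy: "x + f x *\<^sub>R y \<in> Y"
        using x y(1) XY Y by (auto intro: subspace_add subspace_scale)
      \<comment> \<open>As \<open>x + f x *\<^sub>R y\<close> lies in \<open>Y\<close>, its norm is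
        its \<open>p\<close>-value, so \<open>y\<close> can be exchanged for \<open>v\<close> inside
        \<open>p\<close>.\<close>
      have "norm (x + f x *\<^sub>R y) \<le> p (x + f x *\<^sub>R v) + p (f x *\<^sub>R (y - v))"
        using seminorm_triangle_sub[OF sn, of "x + f x *\<^sub>R y" "x + f x *\<^sub>R v"] peq[OF xy]
        by (simp add: scaleR_diff_right)
      also have "p (f x *\<^sub>R (y - v)) = \<bar>f x\<bar> * p (v - y)"
        using seminorm_minus[OF sn, of "v - y"] by (simp add: seminorm_scale[OF sn])
      also have "\<bar>f x\<bar> * p (v - y) \<le> \<phi> * p (v - y)"
        using f_le[OF x] by (intro mult_right_mono seminorm_nonneg sn)
      finally have "1 + \<phi> * (norm y - p (v - y)) - \<delta> \<le> p (x + f x *\<^sub>R v)"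
        using big by (simp add: algebra_simps)
      moreover have "\<phi> * (p v - ?e) \<le> \<phi> * (norm y - p (v - y))"
        using y(3) \<open>\<phi> \<ge> 0\<close> by (intro mult_left_mono) auto
      ultimately have P: "1 + \<phi> * p v - \<phi> * ?e - \<delta> \<le> p (x + f x *\<^sub>R v)"
        by (simp only: right_diff_distrib)
      \<comment> \<open>The summand \<open>x\<close> lies in \<open>Y\<close> and is invisible to
        \<open>d\<close>, so the same \<open>x\<close> also makes the distance part nearly as large
        as \<open>\<phi> * d v\<close>.\<close>
      have "(\<phi> - \<delta> / norm y) * d v \<le> \<bar>f x\<bar> * d v"
        using fx by (intro mult_right_mono seminorm_nonneg d)
      also have "\<dots> = d (f x *\<^sub>R v)" by (simp add: seminorm_scale[OF d])
      also have "\<dots> \<le> d (x + f x *\<^sub>R v)"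
        using seminorm_triangle_sub[OF d, of "f x *\<^sub>R v" "x + f x *\<^sub>R v"]
          dY[of x] XY x(1) by (auto simp: seminorm_minus[OF d])
      finally have D: "\<phi> * d v - \<delta> * (d v / norm y) \<le> d (x + f x *\<^sub>R v)"
        by (simp add: algebra_simps)
      have "\<phi> * ?e \<le> e / 2"
        using \<open>\<phi> \<ge> 0\<close> that by (simp add: field_simps)
      moreover have "\<delta> + \<delta> * (d v / norm y) = e / 2"
      proof -
        have "\<delta> + \<delta> * (d v / norm y) = \<delta> * (1 + d v / norm y)" by (simp add: distrib_left)
        also have "\<dots> = e / 2" using den \<delta>_def nonzero_eq_divide_eq less_irrefl by metis
        finally show ?thesis .
      qed
      ultimately have "1 + \<phi> * N v - e \<le> N (x + T x)"
        using P D unfolding N_def Tf[OF x(1)] distrib_left by linarith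
      also have "\<dots> \<le> Sup ?S"
        by (rule cSup_upper) (use x NX ub in \<open>auto intro!: bdd_aboveI[of _ "1 + \<phi> * N v"]\<close>)
      finally show ?thesis by simp
    qed
    then have "1 + \<phi> * N v \<le> Sup ?S" by (rule field_le_epsilon)
    moreover have "Sup ?S \<le> 1 + \<phi> * N v" by (rule cSup_least[OF ne ub])
    ultimately show "op_norm_on N X (\<lambda>x. x + T x) = 1 + op_norm_on N X T"
      unfolding normT by (simp add: op_norm_on_def)
  qed
  moreover have "\<exists>c C. 0 < c \<and> 0 < C \<and> (\<forall>z. c * norm z \<le> N z \<and> N z \<le> C * norm z)"
    using lower upper by (intro exI[of _ "1/2"] exI[of _ 2]) auto
  ultimately show ?thesis
    using norm NY by blast
qed

end
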